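(* Let $n\ge 2$ and $m\ge 1$, and let $1\ge p_1\ge p_2\ge\dots\ge p_n\ge \tfrac12$ be the proficiencies of $n$ workers. Consider the adversarial task allocation game with $m$ homogeneous tasks (all of utility $1$) and budget $m$, in which the attacker observes only the defender's randomized strategy. Let $k^*$ be the smallest maximizer of $\dfrac{k-1}{\sum_{j=1}^{k}1/p_j}$ over $k\in\{2,\dots,n\}$, and define $$\lambda^*_i=\frac{1}{p_i\sum_{j=1}^{k^*}1/p_j}\quad (1\le i\le k^* ),\qquad \lambda^*_i=0\quad (i>k^* ).$$ Then the randomized strategy that, with probability $\lambda_i^*$, assigns all $m$ tasks to worker $i$ (one worker per task) is an optimal randomized strategy for the defender (i.e. a defender strategy in a strong Stackelberg equilibrium) among all randomized strategies. In particular, given $p_1\ge\dots\ge p_n$ in sorted order, an optimal randomized assignment can be computed in time linear in $n$ (counting arithmetic operations and comparisons).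
   Context: Setting: there are $n$ workers and a set $T$ of $m$ binary labeling tasks. Worker $w$ labels a task correctly with probability $p_w\in[\tfrac12,1]$, independently across workers and tasks; the proficiencies are known to the defender. Every worker is able to complete all tasks. Each task $t$ has an unknown correct label $\iota_t\in\{0,1\}$. A (deterministic) assignment $s$ specifies for each task $t$ a (possibly empty) set $W_t(s)$ of workers, subject to the budget constraint $\sum_{t}|W_t(s)|\le m$; a task may be given to several workers. The defender aggregates the labels received for a task into one label by a fixed deterministic mapping $\delta$ from label vectors in $\{0,1\}^k$, $k\ge1$, to $\{0,1\}$, with $\delta(l)=l$ when a single label is received. The defender obtains utility $u_t$ (here $u_t=1$) from task $t$ if the aggregated label equals $\iota_t$, and $0$ otherwise (in particular if no label is received). The attacker attacks exactly one worker $a$ after the assignment; the labels of worker $a$ are then lost, so the task is decided by the labels of $W_t(s)\setminus\{a\}$ (zero utility if this set is empty). The defender's utility $u_{def}(s,a)$ is the expected total utility over tasks after attack $a$. The game is zero-sum: the attacker minimizes the defender's utility. A randomized strategy is a probability distribution $q$ over assignments. The attacker knows $q$ but not its realization, and best responds; $q$ is optimal (is the defender's part of a strong Stackelberg equilibrium) if it maximizes $\min_{a}\sum_s q_s\,u_{def}(s,a)$. *)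

theory Defs
  imports "HOL-Probability.Probability"
begin

text \<open>
  Workers are \<open>1, \<dots>, n\<close> and tasks are \<open>1, \<dots>, m\<close>; the proficiencies are \<open>p 1, \<dots>, p n\<close>.
  The labels 0 and 1 are \<open>False\<close> and \<open>True\<close>; \<open>\<iota> t\<close> is the correct label of task \<open>t\<close>.
\<close>

definition sorted_proficiencies :: "nat \<Rightarrow> (nat \<Rightarrow> real) \<Rightarrow> bool" where
  "sorted_proficiencies n p \<longleftrightarrow>
     (\<forall>i\<in>{1..n}. 1/2 \<le> p i \<and> p i \<le> 1) \<and>
     (\<forall>i\<in>{1..n}. \<forall>j\<in>{1..n}. i \<le> j \<longrightarrow> p j \<le> p i)"

type_synonym assignment = "nat \<Rightarrow> nat set"

text \<open>Emptiness outside the task set makes two assignments equal iff they agree on all tasks.\<close>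

definition assignments :: "nat \<Rightarrow> nat \<Rightarrow> assignment set" where
  "assignments n m =
     {s. (\<forall>t\<in>{1..m}. s t \<subseteq> {1..n}) \<and> (\<forall>t. t \<notin> {1..m} \<longrightarrow> s t = {}) \<and>
         (\<Sum>t\<in>{1..m}. card (s t)) \<le> m}"

text \<open>
  An aggregation mapping takes a nonempty label vector, listed by increasing worker index;
  its value on the empty list is irrelevant.
\<close>

definition aggregator :: "(bool list \<Rightarrow> bool) \<Rightarrow> bool" where
  "aggregator \<delta> \<longleftrightarrow> (\<forall>l. \<delta> [l] = l)"

text \<open>The random outcome \<open>c (t, w)\<close> says whether worker \<open>w\<close> labels task \<open>t\<close> correctly.\<close>

definition correctness_pmf :: "nat \<Rightarrow> nat \<Rightarrow> (nat \<Rightarrow> real) \<Rightarrow> (nat \<times> nat \<Rightarrow> bool) pmf" where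
  "correctness_pmf n m p = Pi_pmf ({1..m} \<times> {1..n}) False (\<lambda>(t, w). bernoulli_pmf (p w))"

definition label :: "(nat \<Rightarrow> bool) \<Rightarrow> (nat \<times> nat \<Rightarrow> bool) \<Rightarrow> nat \<Rightarrow> nat \<Rightarrow> bool" where
  "label \<iota> c t w = (if c (t, w) then \<iota> t else \<not> \<iota> t)"

definition task_utility ::
  "(nat \<Rightarrow> real) \<Rightarrow> (bool list \<Rightarrow> bool) \<Rightarrow> (nat \<Rightarrow> bool) \<Rightarrow> (nat \<times> nat \<Rightarrow> bool) \<Rightarrow> assignment \<Rightarrow> nat \<Rightarrow> nat \<Rightarrow> real"
where
  "task_utility u \<delta> \<iota> c s a t =
     (if s t - {a} \<noteq> {} \<and> \<delta> (map (label \<iota> c t) (sorted_list_of_set (s t - {a}))) = \<iota> t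
      then u t else 0)"

definition u_def ::
  "nat \<Rightarrow> nat \<Rightarrow> (nat \<Rightarrow> real) \<Rightarrow> (nat \<Rightarrow> real) \<Rightarrow> (bool list \<Rightarrow> bool) \<Rightarrow> (nat \<Rightarrow> bool) \<Rightarrow> assignment \<Rightarrow> nat \<Rightarrow> real"
where
  "u_def n m p u \<delta> \<iota> s a =
     measure_pmf.expectation (correctness_pmf n m p) (\<lambda>c. \<Sum>t\<in>{1..m}. task_utility u \<delta> \<iota> c s a t)"

definition guaranteed_utility ::
  "nat \<Rightarrow> nat \<Rightarrow> (nat \<Rightarrow> real) \<Rightarrow> (nat \<Rightarrow> real) \<Rightarrow> (bool list \<Rightarrow> bool) \<Rightarrow> (nat \<Rightarrow> bool) \<Rightarrow> assignment pmf \<Rightarrow> real"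
where
  "guaranteed_utility n m p u \<delta> \<iota> q =
     Min ((\<lambda>a. measure_pmf.expectation q (\<lambda>s. u_def n m p u \<delta> \<iota> s a)) ` {1..n})"

definition randomized_strategy :: "nat \<Rightarrow> nat \<Rightarrow> assignment pmf \<Rightarrow> bool" where
  "randomized_strategy n m q \<longleftrightarrow> set_pmf q \<subseteq> assignments n m"

definition optimal_strategy ::
  "nat \<Rightarrow> nat \<Rightarrow> (nat \<Rightarrow> real) \<Rightarrow> (nat \<Rightarrow> real) \<Rightarrow> (bool list \<Rightarrow> bool) \<Rightarrow> (nat \<Rightarrow> bool) \<Rightarrow> assignment pmf \<Rightarrow> bool"
where
  "optimal_strategy n m p u \<delta> \<iota> q \<longleftrightarrow>
     randomized_strategy n m q \<and>
     (\<forall>q'. randomized_strategy n m q' \<longrightarrow>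
        guaranteed_utility n m p u \<delta> \<iota> q' \<le> guaranteed_utility n m p u \<delta> \<iota> q)"

definition k_star :: "nat \<Rightarrow> (nat \<Rightarrow> real) \<Rightarrow> nat" where
  "k_star n p =
     (LEAST k. is_arg_max (\<lambda>k. (real k - 1) / (\<Sum>j\<in>{1..k}. 1 / p j)) (\<lambda>k. k \<in> {2..n}) k)"

definition lambda_star :: "nat \<Rightarrow> (nat \<Rightarrow> real) \<Rightarrow> nat \<Rightarrow> real" where
  "lambda_star n p i =
     (if i \<in> {1..k_star n p} then 1 / (p i * (\<Sum>j\<in>{1..k_star n p}. 1 / p j)) else 0)"

definition all_to :: "nat \<Rightarrow> nat \<Rightarrow> assignment" where
  "all_to m i = (\<lambda>t. if t \<in> {1..m} then {i} else {})"

text \<open>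
  For \<open>m \<ge> 1\<close> the assignments \<open>all_to m i\<close> are pairwise distinct, so at most one \<open>q\<close> satisfies
  the next predicate, and it forces \<open>x\<close> to be a probability vector on \<open>{1..n}\<close>.
\<close>

definition single_worker_strategy :: "nat \<Rightarrow> nat \<Rightarrow> (nat \<Rightarrow> real) \<Rightarrow> assignment pmf \<Rightarrow> bool" where
  "single_worker_strategy n m x q \<longleftrightarrow>
     set_pmf q \<subseteq> all_to m ` {1..n} \<and> (\<forall>i\<in>{1..n}. pmf q (all_to m i) = x i)"

text \<open>
  Running time is measured on a real RAM with unit-cost exact real arithmetic. A program uses
  finitely many index registers (natural numbers, which can only be set to constants, copied
  and incremented) and real registers, and addresses an unbounded real memory through index
  registers. Every executed instruction and every evaluated test costs 1, so the cost bounds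
  the number of arithmetic operations and comparisons from above.
\<close>

datatype arith_op = Plus | Minus | Times | Divide

datatype test = IdxLess nat nat | RealLess nat nat

datatype prog =
    Skip
  | IdxConst nat nat
  | IdxCopy nat nat
  | IdxInc nat
  | RealConst nat rat
  | RealCopy nat nat
  | Arith arith_op nat nat nat
  | Load nat nat
  | Store nat nat
  | Seq prog prog
  | IfElse test prog prog
  | While test prog

record ram_state =
  idx :: "nat \<Rightarrow> nat"
  reg :: "nat \<Rightarrow> real"
  mem :: "nat \<Rightarrow> real"

fun arith_eval :: "arith_op \<Rightarrow> real \<Rightarrow> real \<Rightarrow> real" where
  "arith_eval Plus x y = x + y"
| "arith_eval Minus x y = x - y"
| "arith_eval Times x y = x * y"
| "arith_eval Divide x y = x / y"

fun test_eval :: "test \<Rightarrow> ram_state \<Rightarrow> bool" where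
  "test_eval (IdxLess i j) \<sigma> \<longleftrightarrow> idx \<sigma> i < idx \<sigma> j"
| "test_eval (RealLess r r') \<sigma> \<longleftrightarrow> reg \<sigma> r < reg \<sigma> r'"

text \<open>\<open>exec P \<sigma> k \<sigma>'\<close>: started in \<open>\<sigma>\<close>, program \<open>P\<close> halts in state \<open>\<sigma>'\<close> at total cost \<open>k\<close>.\<close>

inductive exec :: "prog \<Rightarrow> ram_state \<Rightarrow> nat \<Rightarrow> ram_state \<Rightarrow> bool" where
  Skip: "exec Skip \<sigma> 1 \<sigma>"
| IdxConst: "exec (IdxConst i v) \<sigma> 1 (\<sigma>\<lparr>idx := (idx \<sigma>)(i := v)\<rparr>)"
| IdxCopy: "exec (IdxCopy i j) \<sigma> 1 (\<sigma>\<lparr>idx := (idx \<sigma>)(i := idx \<sigma> j)\<rparr>)"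
| IdxInc: "exec (IdxInc i) \<sigma> 1 (\<sigma>\<lparr>idx := (idx \<sigma>)(i := idx \<sigma> i + 1)\<rparr>)"
| RealConst: "exec (RealConst r v) \<sigma> 1 (\<sigma>\<lparr>reg := (reg \<sigma>)(r := of_rat v)\<rparr>)"
| RealCopy: "exec (RealCopy r r') \<sigma> 1 (\<sigma>\<lparr>reg := (reg \<sigma>)(r := reg \<sigma> r')\<rparr>)"
| Arith: "exec (Arith f r r1 r2) \<sigma> 1 (\<sigma>\<lparr>reg := (reg \<sigma>)(r := arith_eval f (reg \<sigma> r1) (reg \<sigma> r2))\<rparr>)"
| Load: "exec (Load r i) \<sigma> 1 (\<sigma>\<lparr>reg := (reg \<sigma>)(r := mem \<sigma> (idx \<sigma> i))\<rparr>)"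
| Store: "exec (Store i r) \<sigma> 1 (\<sigma>\<lparr>mem := (mem \<sigma>)(idx \<sigma> i := reg \<sigma> r)\<rparr>)"
| Seq: "exec P \<sigma> k1 \<sigma>1 \<Longrightarrow> exec Q \<sigma>1 k2 \<sigma>2 \<Longrightarrow> exec (Seq P Q) \<sigma> (k1 + k2) \<sigma>2"
| IfTrue: "test_eval b \<sigma> \<Longrightarrow> exec P \<sigma> k \<sigma>1 \<Longrightarrow> exec (IfElse b P Q) \<sigma> (1 + k) \<sigma>1"
| IfFalse: "\<not> test_eval b \<sigma> \<Longrightarrow> exec Q \<sigma> k \<sigma>1 \<Longrightarrow> exec (IfElse b P Q) \<sigma> (1 + k) \<sigma>1"
| WhileFalse: "\<not> test_eval b \<sigma> \<Longrightarrow> exec (While b P) \<sigma> 1 \<sigma>"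
| WhileTrue: "test_eval b \<sigma> \<Longrightarrow> exec P \<sigma> k1 \<sigma>1 \<Longrightarrow> exec (While b P) \<sigma>1 k2 \<sigma>2 \<Longrightarrow>
    exec (While b P) \<sigma> (1 + k1 + k2) \<sigma>2"

inductive_cases exec_SkipE: "exec Skip \<sigma> k \<sigma>'"
inductive_cases exec_IdxConstE: "exec (IdxConst i v) \<sigma> k \<sigma>'"
inductive_cases exec_IdxCopyE: "exec (IdxCopy i j) \<sigma> k \<sigma>'"
inductive_cases exec_IdxIncE: "exec (IdxInc i) \<sigma> k \<sigma>'"
inductive_cases exec_RealConstE: "exec (RealConst r v) \<sigma> k \<sigma>'"
inductive_cases exec_RealCopyE: "exec (RealCopy r r') \<sigma> k \<sigma>'"
inductive_cases exec_ArithE: "exec (Arith f r r1 r2) \<sigma> k \<sigma>'"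
inductive_cases exec_LoadE: "exec (Load r i) \<sigma> k \<sigma>'"
inductive_cases exec_StoreE: "exec (Store i r) \<sigma> k \<sigma>'"
inductive_cases exec_SeqE: "exec (Seq P Q) \<sigma> k \<sigma>'"
inductive_cases exec_IfElseE: "exec (IfElse b P Q) \<sigma> k \<sigma>'"
inductive_cases exec_WhileE: "exec (While b P) \<sigma> k \<sigma>'"

lemmas exec_elims = exec_SkipE exec_IdxConstE exec_IdxCopyE exec_IdxIncE exec_RealConstE
  exec_RealCopyE exec_ArithE exec_LoadE exec_StoreE exec_SeqE exec_IfElseE exec_WhileE

lemma exec_deterministic:
  "exec P \<sigma> k \<sigma>1 \<Longrightarrow> exec P \<sigma> l \<sigma>2 \<Longrightarrow> l = k \<and> \<sigma>2 = \<sigma>1"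
proof (induction arbitrary: l \<sigma>2 rule: exec.induct)
  case (Seq P \<sigma> k1 \<sigma>1 Q k2 \<sigma>')
  from Seq.prems show ?case by (rule exec_SeqE) (auto dest: Seq.IH)
next
  case (IfTrue b \<sigma> P k \<sigma>1 Q)
  from IfTrue.prems show ?case
    by (rule exec_IfElseE) (auto dest: IfTrue.IH simp: IfTrue.hyps)
next
  case (IfFalse b \<sigma> Q k \<sigma>1 P)
  from IfFalse.prems show ?case
    by (rule exec_IfElseE) (auto dest: IfFalse.IH simp: IfFalse.hyps)
next
  case (WhileFalse b \<sigma> P)
  from WhileFalse.prems show ?case by (rule exec_WhileE) (auto simp: WhileFalse.hyps)
next
  case (WhileTrue b \<sigma> P k1 \<sigma>1 k2 \<sigma>')
  from WhileTrue.prems show ?case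
    by (rule exec_WhileE) (auto dest!: WhileTrue.IH simp: WhileTrue.hyps)
qed (erule exec_elims; simp)+

text \<open>
  Input: index register 0 holds \<open>n\<close> and memory cells \<open>1, \<dots>, n\<close> hold \<open>p 1, \<dots>, p n\<close>; everything
  else is 0. Output: memory cells \<open>1, \<dots>, n\<close> on halting.
\<close>

definition ram_input :: "nat \<Rightarrow> (nat \<Rightarrow> real) \<Rightarrow> ram_state" where
  "ram_input n p =
     \<lparr>idx = (\<lambda>_. 0)(0 := n), reg = (\<lambda>_. 0), mem = (\<lambda>i. if i \<in> {1..n} then p i else 0)\<rparr>"

end

theory Submission
  imports Defs
begin

text \<open>
  Let \<open>V = (k - 1) / (1 / p 1 + \<dots> + 1 / p k)\<close>, where \<open>k\<close> is any cutoff with \<open>p k \<ge> V \<ge> p (k + 1)\<close>;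
  local maximality of the ratio at \<open>k\<close> amounts to these inequalities because the ratio at \<open>k + 1\<close> is
  the mediant of the ratio at \<open>k\<close> and \<open>p (k + 1)\<close>. The strategy \<open>\<lambda>\<close> guarantees \<open>m V\<close>. Conversely,
  if the attacker attacks worker \<open>a \<le> k\<close> with probability \<open>1 - V / p a\<close>, then a task given to \<open>r\<close>
  workers earns at most \<open>r V\<close>: for \<open>r = 1\<close> by the choice of the probabilities, for \<open>r \<ge> 3\<close> since
  \<open>V \<ge> 1/3\<close>, and for \<open>r = 2\<close> because \<open>(p i + p j - 1) (V / p i + V / p j - 1) \<ge> 0\<close>. The
  aggregation of two or more labels enters only through the trivial bound 1, so \<open>\<delta>\<close> is irrelevant.
  A single scan finds a cutoff.
\<close>

section \<open>Expected utilities\<close>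

lemma set_pmf_correctness_finite: "finite (set_pmf (correctness_pmf n m p))"
  unfolding correctness_pmf_def
  by (auto simp: set_Pi_pmf intro!: finite_PiE_dflt)

lemma integrable_correctness:
  fixes f :: "(nat \<times> nat \<Rightarrow> bool) \<Rightarrow> real"
  shows "integrable (correctness_pmf n m p) f"
  by (rule integrable_measure_pmf_finite[OF set_pmf_correctness_finite])

lemma u_def_eq_sum:
  "u_def n m p u \<delta> \<iota> s a =
     (\<Sum>t\<in>{1..m}. measure_pmf.expectation (correctness_pmf n m p) (\<lambda>c. task_utility u \<delta> \<iota> c s a t))"
  unfolding u_def_def by (rule Bochner_Integration.integral_sum) (rule integrable_correctness)

text \<open>Success probability of task \<open>t\<close> with surviving workers \<open>U\<close>.
  Assignment and attack enter only through \<open>U\<close>, so all bounds can be proved task by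
  task.\<close>

definition accuracy ::
  "nat \<Rightarrow> nat \<Rightarrow> (nat \<Rightarrow> real) \<Rightarrow> (bool list \<Rightarrow> bool) \<Rightarrow> (nat \<Rightarrow> bool) \<Rightarrow> nat \<Rightarrow> nat set \<Rightarrow> real"
where
  "accuracy n m p \<delta> \<iota> t U = measure_pmf.expectation (correctness_pmf n m p)
     (\<lambda>c. of_bool (U \<noteq> {} \<and> \<delta> (map (label \<iota> c t) (sorted_list_of_set U)) = \<iota> t))"

lemma u_def_accuracy:
  "u_def n m p (\<lambda>_. 1) \<delta> \<iota> s a = (\<Sum>t\<in>{1..m}. accuracy n m p \<delta> \<iota> t (s t - {a}))"
  unfolding u_def_eq_sum accuracy_def task_utility_def
  by (intro sum.cong refl Bochner_Integration.integral_cong) auto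

lemma accuracy_empty: "accuracy n m p \<delta> \<iota> t {} = 0"
  by (simp add: accuracy_def)

lemma accuracy_nonneg: "0 \<le> accuracy n m p \<delta> \<iota> t U"
  unfolding accuracy_def by (rule Bochner_Integration.integral_nonneg) auto

lemma accuracy_le_one: "accuracy n m p \<delta> \<iota> t U \<le> 1"
  unfolding accuracy_def by (rule measure_pmf.integral_le_const[OF integrable_correctness]) auto

text \<open>An aggregator returns a lone label unchanged, so success is the event
  \<open>c (t, w)\<close>, whose marginal in the product distribution is Bernoulli.\<close>

lemma accuracy_single:
  assumes "aggregator \<delta>" "sorted_proficiencies n p" "t \<in> {1..m}" "w \<in> {1..n}"
  shows "accuracy n m p \<delta> \<iota> t {w} = p w"
proof -
  have "1/2 \<le> p w \<and> p w \<le> 1"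
    using assms(2,4) unfolding sorted_proficiencies_def by blast
  then have p: "0 \<le> p w" "p w \<le> 1" by auto
  have "accuracy n m p \<delta> \<iota> t {w} =
      measure_pmf.expectation (correctness_pmf n m p) (\<lambda>c. of_bool (c (t, w)))"
    using assms(1) unfolding accuracy_def aggregator_def label_def
    by (intro Bochner_Integration.integral_cong) auto
  also have "\<dots> = measure_pmf.expectation (map_pmf (\<lambda>c. c (t, w)) (correctness_pmf n m p)) of_bool"
    by simp
  also have "map_pmf (\<lambda>c. c (t, w)) (correctness_pmf n m p) = bernoulli_pmf (p w)"
    unfolding correctness_pmf_def using assms by (subst Pi_pmf_component) auto
  also have "measure_pmf.expectation (bernoulli_pmf (p w)) of_bool = p w"
    using p by simp
  finally show ?thesis .
qed

lemma u_def_bounds: "0 \<le> u_def n m p (\<lambda>_. 1) \<delta> \<iota> s a" "u_def n m p (\<lambda>_. 1) \<delta> \<iota> s a \<le> real m"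
  using sum_bounded_above[of "{1..m}" "\<lambda>t. accuracy n m p \<delta> \<iota> t (s t - {a})" 1]
  unfolding u_def_accuracy by (auto intro!: sum_nonneg accuracy_nonneg accuracy_le_one)

lemma integrable_u_def:
  fixes q :: "assignment pmf"
  shows "integrable q (\<lambda>s. u_def n m p (\<lambda>_. 1) \<delta> \<iota> s a)"
  by (rule measure_pmf.integrable_const_bound[where B = "real m"]) (use u_def_bounds in auto)

section \<open>Strategies that give all tasks to one worker\<close>

lemma u_def_all_to:
  assumes "aggregator \<delta>" "sorted_proficiencies n p" "i \<in> {1..n}"
  shows "u_def n m p (\<lambda>_. 1) \<delta> \<iota> (all_to m i) a = (if i = a then 0 else real m * p i)"
proof -
  have "accuracy n m p \<delta> \<iota> t (all_to m i t - {a}) = (if i = a then 0 else p i)"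
    if "t \<in> {1..m}" for t
    using accuracy_single[OF assms(1,2) that assms(3)] that
    by (auto simp: all_to_def accuracy_empty)
  then show ?thesis
    unfolding u_def_accuracy by (simp del: atLeastAtMost_iff)
qed

lemma inj_all_to:
  assumes "1 \<le> m"
  shows "inj (all_to m)"
proof (rule injI)
  fix i j assume "all_to m i = all_to m j"
  then have "all_to m i 1 = all_to m j 1" by simp
  then show "i = j" using assms by (simp add: all_to_def)
qed

lemma all_to_in_assignments: "i \<in> {1..n} \<Longrightarrow> all_to m i \<in> assignments n m"
  by (auto simp: assignments_def all_to_def)

text \<open>Draw the worker from \<open>x\<close> and push forward along \<open>all_to m\<close>;
  injectivity carries the point masses over.\<close>

lemma single_worker_strategy_exists:
  assumes "1 \<le> m" and nonneg: "\<And>i. i \<in> {1..n} \<Longrightarrow> 0 \<le> x i" and sum: "sum x {1..n} = 1"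
  shows "\<exists>q. single_worker_strategy n m x q"
proof -
  define f where "f i = (if i \<in> {1..n} then x i else 0)" for i
  have f0: "0 \<le> f i" for i using nonneg by (simp add: f_def)
  have "(\<integral>\<^sup>+ i. ennreal (f i) \<partial>count_space UNIV) = (\<Sum>i\<in>{1..n}. ennreal (f i))"
    by (rule nn_integral_count_space') (auto simp: f_def)
  also have "\<dots> = ennreal (sum f {1..n})"
    using f0 by (intro sum_ennreal) auto
  also have "sum f {1..n} = 1"
    using sum by (simp add: f_def)
  finally have int: "(\<integral>\<^sup>+ i. ennreal (f i) \<partial>count_space UNIV) = 1" by simp
  define r where "r = embed_pmf f"
  have r: "pmf r i = f i" for i
    unfolding r_def by (rule pmf_embed_pmf[OF f0 int])
  have "set_pmf r \<subseteq> {1..n}"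
    by (auto simp: set_pmf_iff r f_def split: if_splits)
  then have "single_worker_strategy n m x (map_pmf (all_to m) r)"
    unfolding single_worker_strategy_def
    by (auto simp: pmf_map_inj'[OF inj_all_to[OF assms(1)]] r f_def)
  then show ?thesis ..
qed

section \<open>Cutoffs and optimality\<close>

text \<open>Abstracts from how \<open>k\<close> is found: the smallest maximizer and the index where
  the scan of the program stops are both instances, so one optimality proof serves both and the two
  indices never have to be compared.\<close>

locale cutoff =
  fixes n :: nat and p :: "nat \<Rightarrow> real" and k :: nat
  assumes prof: "sorted_proficiencies n p"
    and k2: "2 \<le> k" and kn: "k \<le> n"
    and cut_le: "(real k - 1) / (\<Sum>j\<in>{1..k}. 1 / p j) \<le> p k"
    and cut_ge: "k < n \<Longrightarrow> p (Suc k) \<le> (real k - 1) / (\<Sum>j\<in>{1..k}. 1 / p j)"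
begin

definition S :: real where "S = (\<Sum>j\<in>{1..k}. 1 / p j)"

definition V :: real where "V = (real k - 1) / S"

text \<open>The mixed strategy of the attacker in the minimax argument.\<close>
definition y :: "nat \<Rightarrow> real" where "y a = (if a \<le> k then 1 - V / p a else 0)"

text \<open>Equalizes \<open>p i * lam i = 1 / S\<close> on \<open>{1..k}\<close>, so losing any of
  these workers costs the same.\<close>

definition lam :: "nat \<Rightarrow> real" where "lam i = (if i \<in> {1..k} then 1 / (p i * S) else 0)"

lemma p_half: "i \<in> {1..n} \<Longrightarrow> 1/2 \<le> p i" and p_one: "i \<in> {1..n} \<Longrightarrow> p i \<le> 1"
  using prof unfolding sorted_proficiencies_def by auto

lemma p_pos: "i \<in> {1..n} \<Longrightarrow> 0 < p i"
  using p_half[of i] by auto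

lemma p_anti: "1 \<le> i \<Longrightarrow> i \<le> j \<Longrightarrow> j \<le> n \<Longrightarrow> p j \<le> p i"
  using prof unfolding sorted_proficiencies_def by auto

lemma S_pos: "0 < S"
  unfolding S_def using k2 kn p_pos by (intro sum_pos) auto

lemma V_pos: "0 < V"
  unfolding V_def using S_pos k2 by auto

lemma V_le: "1 \<le> i \<Longrightarrow> i \<le> k \<Longrightarrow> V \<le> p i"
  using cut_le p_anti[of i k] kn unfolding V_def S_def by auto

lemma V_ge: "k < i \<Longrightarrow> i \<le> n \<Longrightarrow> p i \<le> V"
  using cut_ge p_anti[of "Suc k" i] unfolding V_def S_def by auto

text \<open>This normalization makes the attack probabilities \<open>1 - V / p a\<close> add up to
  1.\<close>

lemma sum_V: "(\<Sum>j\<in>{1..k}. V / p j) = real k - 1"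
proof -
  have "(\<Sum>j\<in>{1..k}. V / p j) = V * S"
    unfolding S_def by (simp add: sum_distrib_left)
  then show ?thesis using S_pos by (simp add: V_def)
qed

lemma sum_upto_k: "(\<And>i. k < i \<Longrightarrow> i \<le> n \<Longrightarrow> f i = 0) \<Longrightarrow> sum f {1..n} = sum f {1..k}"
  for f :: "nat \<Rightarrow> real"
  using kn by (intro sum.mono_neutral_right) auto

lemma y_nonneg: "a \<in> {1..n} \<Longrightarrow> 0 \<le> y a"
  using V_le[of a] p_pos[of a] by (auto simp: y_def field_simps)

lemma sum_y: "sum y {1..n} = 1"
proof -
  have "sum y {1..n} = (\<Sum>a\<in>{1..k}. 1 - V / p a)"
    by (subst sum_upto_k) (auto simp: y_def)
  also have "\<dots> = 1"
    unfolding sum_subtractf sum_V by simp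
  finally show ?thesis .
qed

lemma lam_nonneg: "0 \<le> lam i"
  using p_pos[of i] kn S_pos by (auto simp: lam_def)

lemma sum_lam: "sum lam {1..n} = 1"
proof -
  have "sum lam {1..n} = (\<Sum>i\<in>{1..k}. 1 / p i / S)"
    by (subst sum_upto_k) (auto simp: lam_def)
  also have "\<dots> = S / S"
    unfolding S_def sum_divide_distrib ..
  finally show ?thesis using S_pos by simp
qed

section \<open>Earnings of one task against the attacker's mixed strategy\<close>

text \<open>The \<open>k\<close> terms \<open>V / p l\<close> add up to \<open>k - 1\<close> and
  each is at most 1, so those other than \<open>i\<close> and \<open>j\<close> take up at most
  \<open>k - 2\<close>.\<close>

lemma pair_bound:
  assumes "1 \<le> i" "i < j" "j \<le> k"
  shows "1 \<le> V / p i + V / p j"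
proof -
  have "(\<Sum>l\<in>{1..k} - {i, j}. V / p l) \<le> (\<Sum>l\<in>{1..k} - {i, j}. 1)"
    using V_le p_pos kn by (intro sum_mono) auto
  also have "\<dots> = real k - 2"
    using assms by (simp add: card_Diff_subset of_nat_diff)
  finally have "(\<Sum>l\<in>{1..k} - {i, j}. V / p l) \<le> real k - 2" .
  moreover have "(\<Sum>l\<in>{1..k}. V / p l) = (\<Sum>l\<in>{1..k} - {i, j}. V / p l) + (\<Sum>l\<in>{i, j}. V / p l)"
    using assms by (intro sum.subset_diff) auto
  ultimately show ?thesis
    using sum_V assms by auto
qed

text \<open>For \<open>k = 2\<close>, worker 3 lies beyond the cutoff and
  \<open>V \<ge> p 3 \<ge> 1/2\<close>. For \<open>k \<ge> 3\<close>, \<open>S \<le> 2 * k\<close>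
  gives \<open>V \<ge> (k - 1) / (2 * k) \<ge> 1/3\<close>.\<close>

lemma V_third:
  assumes "3 \<le> n"
  shows "1/3 \<le> V"
proof (cases "k = 2")
  case True
  then show ?thesis using V_ge[of 3] p_half[of 3] assms by auto
next
  case False
  have "S \<le> (\<Sum>j\<in>{1..k}. 2)"
    unfolding S_def
  proof (intro sum_mono)
    fix i assume "i \<in> {1..k}"
    then show "1 / p i \<le> 2" using p_half[of i] kn by (auto simp: field_simps)
  qed
  then show ?thesis
    using False k2 S_pos by (auto simp: V_def field_simps)
qed

text \<open>The left side bounds the earnings of a task given to \<open>i\<close> and
  \<open>j\<close>: an attack on one leaves the other alone, and any other attack is credited with
  1.\<close>

lemma two_worker_bound:
  assumes "1 \<le> i" "i < j" "j \<le> n"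
  shows "y i * p j + y j * p i + (1 - y i - y j) \<le> 2 * V"
proof -
  have ij: "i \<in> {1..n}" "j \<in> {1..n}" using assms by auto
  note pp = p_half[OF ij(1)] p_half[OF ij(2)] p_one[OF ij(1)] p_one[OF ij(2)] p_pos[OF ij(1)] p_pos[OF ij(2)]
  consider "j \<le> k" | "i \<le> k" "k < j" | "k < i" using assms by linarith
  then show ?thesis
  proof cases
    case 1
    \<comment> \<open>The first factor is nonnegative because proficiencies are at least 1/2, the
      second by \<open>pair_bound\<close>.\<close>
    have "0 \<le> (p i + p j - 1) * (V / p i + V / p j - 1)"
      using pair_bound[of i j] 1 assms pp by (intro mult_nonneg_nonneg) auto
    also have "\<dots> = 2 * V - (y i * p j + y j * p i + (1 - y i - y j))"
      using 1 assms pp by (simp add: y_def field_simps)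
    finally show ?thesis by simp
  next
    case 2
    \<comment> \<open>Here \<open>y j = 0\<close>, and the left side is
      \<open>p j + V * (1 - p j) / p i\<close>. Both summands are at most \<open>V\<close>, the
      second since \<open>1 - p j \<le> 1/2 \<le> p i\<close>.\<close>
    have "V * (1 - p j) \<le> V * p i"
      using pp V_pos by (intro mult_left_mono) auto
    then have "V * (1 - p j) / p i \<le> V"
      using pp by (simp add: field_simps)
    moreover have "p j \<le> V" using V_ge[of j] 2 assms by auto
    moreover have "y i * p j + y j * p i + (1 - y i - y j) = p j + V * (1 - p j) / p i"
      using 2 pp by (simp add: y_def field_simps)
    ultimately show ?thesis by simp
  next
    case 3
    \<comment> \<open>Both attack probabilities vanish, so the left side is 1, while
      \<open>V \<ge> p i \<ge> 1/2\<close>.\<close>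
    then show ?thesis using V_ge[of i] pp assms by (auto simp: y_def)
  qed
qed

text \<open>\<open>g\<close> abstracts the accuracy of one task. Charging \<open>V\<close> per
  worker used makes the bound add up over tasks to \<open>V\<close> times the budget.\<close>

lemma task_bound:
  fixes g :: "nat set \<Rightarrow> real"
  assumes W: "W \<subseteq> {1..n}"
    and g0: "g {} = 0" and g1: "\<And>w. w \<in> {1..n} \<Longrightarrow> g {w} = p w" and g_le: "\<And>U. g U \<le> 1"
  shows "(\<Sum>a\<in>{1..n}. y a * g (W - {a})) \<le> V * real (card W)"
proof -
  have fin: "finite W" using W finite_subset by blast
  consider "card W = 0" | "card W = 1" | "card W = 2" | "3 \<le> card W" by linarith
  then show ?thesis
  proof cases
    case 1
    then show ?thesis using fin g0 by simp
  next
    case 2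
    then obtain w where w: "W = {w}" by (auto simp: card_1_singleton_iff)
    then have wn: "w \<in> {1..n}" using W by auto
    have "(\<Sum>a\<in>{1..n}. y a * g (W - {a})) = (\<Sum>a\<in>{1..n} - {w}. y a * p w)"
      using wn g0 g1 w by (simp add: sum.remove[of _ w])
    also have "\<dots> = (1 - y w) * p w"
      using wn sum_y by (simp add: sum_distrib_right[symmetric] sum_diff1)
    \<comment> \<open>Equality if \<open>w \<le> k\<close>, since then
      \<open>1 - y w = V / p w\<close>; otherwise \<open>y w = 0\<close> and
      \<open>p w \<le> V\<close>.\<close>
    also have "\<dots> \<le> V"
      using V_ge[of w] p_pos[of w] wn by (auto simp: y_def)
    finally show ?thesis using w by simp
  next
    case 3
    obtain i j where ij: "W = {i, j}" "i < j"
    proof -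
      obtain i j where "W = {i, j}" "i \<noteq> j" using 3 by (auto simp: card_2_iff)
      then show ?thesis using that[of i j] that[of j i] by (cases "i < j") auto
    qed
    then have inn: "i \<in> {1..n}" "j \<in> {1..n}" using W by auto
    have split: "sum f {1..n} = sum f ({1..n} - {i, j}) + (f i + f j)" for f :: "nat \<Rightarrow> real"
      using inn ij sum.subset_diff[of "{i, j}" "{1..n}" f] by simp
    have "(\<Sum>a\<in>{1..n} - {i, j}. y a * g (W - {a})) \<le> sum y ({1..n} - {i, j})"
    proof (intro sum_mono)
      fix a assume "a \<in> {1..n} - {i, j}"
      then show "y a * g (W - {a}) \<le> y a"
        using mult_left_mono[OF g_le, of "y a"] y_nonneg[of a] by simp
    qed
    also have "\<dots> = 1 - y i - y j"
      using split[of y] sum_y by simp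
    moreover have "W - {i} = {j}" "W - {j} = {i}" using ij by auto
    ultimately have "(\<Sum>a\<in>{1..n}. y a * g (W - {a})) \<le> y i * p j + y j * p i + (1 - y i - y j)"
      unfolding split[of "\<lambda>a. y a * g (W - {a})"] using g1 inn by simp
    also have "\<dots> \<le> 2 * V"
      using two_worker_bound[of i j] ij inn by auto
    finally show ?thesis using 3 by simp
  next
    case 4
    have "(\<Sum>a\<in>{1..n}. y a * g (W - {a})) \<le> sum y {1..n}"
    proof (intro sum_mono)
      fix a assume "a \<in> {1..n}"
      then show "y a * g (W - {a}) \<le> y a"
        using mult_left_mono[OF g_le, of "y a"] y_nonneg[of a] by simp
    qed
    \<comment> \<open>Written as a product for a factorwise comparison with
      \<open>card W * V\<close>; \<open>card W \<le> n\<close> supplies \<open>3 \<le> n\<close> for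
      \<open>V_third\<close>.\<close>
    also have "\<dots> \<le> 3 * (1/3)" using sum_y by simp
    also have "\<dots> \<le> real (card W) * V"
      using V_third 4 card_mono[OF _ W] V_pos by (intro mult_mono) auto
    finally show ?thesis by (simp add: mult.commute)
  qed
qed

section \<open>Upper and lower bound on the value of the game\<close>

lemma assignment_bound:
  assumes "aggregator \<delta>" "s \<in> assignments n m"
  shows "(\<Sum>a\<in>{1..n}. y a * u_def n m p (\<lambda>_. 1) \<delta> \<iota> s a) \<le> real m * V"
proof -
  have "(\<Sum>a\<in>{1..n}. y a * u_def n m p (\<lambda>_. 1) \<delta> \<iota> s a) =
      (\<Sum>t\<in>{1..m}. \<Sum>a\<in>{1..n}. y a * accuracy n m p \<delta> \<iota> t (s t - {a}))"
    unfolding u_def_accuracy sum_distrib_left by (rule sum.swap)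
  also have "\<dots> \<le> (\<Sum>t\<in>{1..m}. V * real (card (s t)))"
    using assms(2)
    by (intro sum_mono task_bound accuracy_empty accuracy_le_one accuracy_single[OF assms(1) prof])
      (auto simp: assignments_def)
  also have "\<dots> = V * real (\<Sum>t\<in>{1..m}. card (s t))"
    by (simp add: sum_distrib_left)
  also have "\<dots> \<le> V * real m"
    using assms(2) V_pos unfolding assignments_def
    by (intro mult_left_mono) (auto simp flip: of_nat_sum)
  finally show ?thesis by (simp add: mult.commute)
qed

text \<open>Weak duality: the minimum over attacks is at most their average weighted by
  \<open>y\<close>, and this average is bounded for every assignment in the support.\<close>

lemma guaranteed_utility_le:
  assumes "aggregator \<delta>" "randomized_strategy n m q"
  shows "guaranteed_utility n m p (\<lambda>_. 1) \<delta> \<iota> q \<le> real m * V"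
proof -
  let ?u = "\<lambda>s a. u_def n m p (\<lambda>_. 1) \<delta> \<iota> s a"
  let ?G = "guaranteed_utility n m p (\<lambda>_. 1) \<delta> \<iota> q"
  have "?G = (\<Sum>a\<in>{1..n}. y a * ?G)"
    unfolding sum_distrib_right[symmetric] sum_y by simp
  also have "\<dots> \<le> (\<Sum>a\<in>{1..n}. y a * measure_pmf.expectation q (\<lambda>s. ?u s a))"
    unfolding guaranteed_utility_def by (intro sum_mono mult_left_mono y_nonneg Min_le) auto
  also have "\<dots> = measure_pmf.expectation q (\<lambda>s. \<Sum>a\<in>{1..n}. y a * ?u s a)"
    by (simp add: Bochner_Integration.integral_sum integrable_u_def)
  also have "\<dots> \<le> real m * V"
  proof (rule measure_pmf.integral_le_const)
    show "integrable q (\<lambda>s. \<Sum>a\<in>{1..n}. y a * ?u s a)"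
      by (intro Bochner_Integration.integrable_sum integrable_mult_right integrable_u_def)
    show "AE s in q. (\<Sum>a\<in>{1..n}. y a * ?u s a) \<le> real m * V"
      using assms(2) assignment_bound[OF assms(1)]
      by (auto simp: AE_measure_pmf_iff randomized_strategy_def)
  qed
  finally show ?thesis .
qed

text \<open>Each worker \<open>i \<le> k\<close> other than \<open>a\<close> contributes
  \<open>m * p i * lam i = m / S\<close>, and at least \<open>k - 1\<close> such workers survive the
  attack.\<close>

lemma guaranteed_utility_ge:
  assumes "aggregator \<delta>" "1 \<le> m" "single_worker_strategy n m lam q"
  shows "real m * V \<le> guaranteed_utility n m p (\<lambda>_. 1) \<delta> \<iota> q"
proof -
  have "real m * V \<le> measure_pmf.expectation q (\<lambda>s. u_def n m p (\<lambda>_. 1) \<delta> \<iota> s a)"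
    if a: "a \<in> {1..n}" for a
  proof -
    let ?u = "\<lambda>s. u_def n m p (\<lambda>_. 1) \<delta> \<iota> s a"
    have "measure_pmf.expectation q ?u = (\<Sum>s\<in>all_to m ` {1..n}. ?u s * pmf q s)"
      using assms(3) by (intro integral_measure_pmf_real) (auto simp: single_worker_strategy_def)
    also have "\<dots> = (\<Sum>i\<in>{1..n}. ?u (all_to m i) * pmf q (all_to m i))"
      by (subst sum.reindex) (auto intro: inj_on_subset[OF inj_all_to[OF assms(2)]])
    also have "\<dots> = (\<Sum>i\<in>{1..n}. if i = a then 0 else real m * p i * lam i)"
      using assms(3) unfolding single_worker_strategy_def
      by (intro sum.cong) (auto simp: u_def_all_to[OF assms(1) prof])
    also have "\<dots> = (\<Sum>i\<in>{1..k}. if i = a then 0 else real m * p i * lam i)"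
      by (rule sum_upto_k) (simp add: lam_def)
    also have "\<dots> = (\<Sum>i\<in>{1..k}. (if i = a then 0 else real m / S))"
    proof (intro sum.cong refl)
      fix i assume "i \<in> {1..k}"
      then show "(if i = a then 0 else real m * p i * lam i) = (if i = a then 0 else real m / S)"
        using p_pos[of i] kn by (auto simp: lam_def)
    qed
    also have "\<dots> = (\<Sum>i\<in>{1..k} - {a}. real m / S)"
      by (intro sum.mono_neutral_cong_right) auto
    also have "\<dots> = real (card ({1..k} - {a})) * (real m / S)"
      by simp
    finally have eq: "measure_pmf.expectation q ?u = real (card ({1..k} - {a})) * (real m / S)" .
    \<comment> \<open>Equality for \<open>a \<le> k\<close>; an attack beyond the cutoff leaves all
      \<open>k\<close> terms.\<close>
    have "real k - 1 \<le> real (card ({1..k} - {a}))"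
      using k2 by (auto simp: card_Diff_singleton_if)
    then have "(real k - 1) * (real m / S) \<le> real (card ({1..k} - {a})) * (real m / S)"
      using S_pos by (intro mult_right_mono) auto
    then show ?thesis unfolding eq V_def by (simp add: mult.commute)
  qed
  then show ?thesis
    unfolding guaranteed_utility_def using k2 kn by (subst Min_ge_iff) auto
qed

text \<open>\<open>x\<close> is tied to \<open>lam\<close> only on \<open>{1..n}\<close>, since the
  output of the program is specified only there.\<close>

lemma optimal:
  assumes "1 \<le> m" and x: "\<And>i. i \<in> {1..n} \<Longrightarrow> x i = lam i"
  shows "\<exists>q. single_worker_strategy n m x q \<and>
           (\<forall>\<delta> \<iota>. aggregator \<delta> \<longrightarrow> optimal_strategy n m p (\<lambda>_. 1) \<delta> \<iota> q)"
proof -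
  obtain q where q: "single_worker_strategy n m lam q"
    using single_worker_strategy_exists[OF assms(1) lam_nonneg sum_lam] by blast
  have "randomized_strategy n m q"
    using q all_to_in_assignments
    unfolding single_worker_strategy_def randomized_strategy_def by blast
  then have "optimal_strategy n m p (\<lambda>_. 1) \<delta> \<iota> q" if "aggregator \<delta>" for \<delta> \<iota>
    unfolding optimal_strategy_def
    using guaranteed_utility_le[OF that] guaranteed_utility_ge[OF that assms(1) q]
    by (meson order_trans)
  moreover have "single_worker_strategy n m x q"
    using q x by (simp add: single_worker_strategy_def)
  ultimately show ?thesis by blast
qed

end

section \<open>The smallest maximizer is a cutoff\<close>

text \<open>Passing to \<open>Suc j\<close> adds 1 to the numerator and \<open>1 / p (Suc j)\<close>
  to the denominator, so the new ratio lies between \<open>F j\<close> and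
  \<open>p (Suc j)\<close>.\<close>

lemma ratio_Suc_le_iff:
  fixes p :: "nat \<Rightarrow> real"
  assumes "\<And>i. i \<in> {1..Suc j} \<Longrightarrow> 0 < p i" "1 \<le> j"
  defines "F \<equiv> \<lambda>k. (real k - 1) / (\<Sum>i\<in>{1..k}. 1 / p i)"
  shows "F (Suc j) \<le> F j \<longleftrightarrow> p (Suc j) \<le> F j"
    and "F j \<le> F (Suc j) \<longleftrightarrow> F (Suc j) \<le> p (Suc j)"
proof -
  define A where "A = (\<Sum>i\<in>{1..j}. 1 / p i)"
  have A: "0 < A" unfolding A_def using assms(1,2) by (intro sum_pos) auto
  have P: "0 < p (Suc j)" using assms(1) by simp
  have B: "0 < A + 1 / p (Suc j)" using A P by (simp add: add_pos_pos)
  have F: "F j = (real j - 1) / A" "F (Suc j) = real j / (A + 1 / p (Suc j))"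
    by (auto simp: F_def A_def)
  show "F (Suc j) \<le> F j \<longleftrightarrow> p (Suc j) \<le> F j"
    unfolding F using A P B by (simp add: field_simps)
  have "F j \<le> F (Suc j) \<longleftrightarrow> real j \<le> p (Suc j) * A + 1"
    unfolding F using A P B by (simp add: field_simps)
  also have "\<dots> \<longleftrightarrow> F (Suc j) \<le> p (Suc j)"
    unfolding F pos_divide_le_eq[OF B] using P by (simp add: distrib_left)
  finally show "F j \<le> F (Suc j) \<longleftrightarrow> F (Suc j) \<le> p (Suc j)" .
qed

lemma cutoff_k_star:
  assumes "2 \<le> n" and prof: "sorted_proficiencies n p"
  shows "cutoff n p (k_star n p)"
proof -
  let ?F = "\<lambda>k. (real k - 1) / (\<Sum>j\<in>{1..k}. 1 / p j)"
  define k where "k = k_star n p"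
  have pos: "0 < p i" if "i \<in> {1..n}" for i
    using prof that unfolding sorted_proficiencies_def by force
  \<comment> \<open>A maximizer exists, so the \<open>LEAST\<close> in \<open>k_star\<close> is one;
    comparing it with its two neighbours then gives the cutoff inequalities.\<close>
  have "Max (?F ` {2..n}) \<in> ?F ` {2..n}" using assms(1) by (intro Max_in) auto
  then obtain k0 where k0: "Max (?F ` {2..n}) = ?F k0" "k0 \<in> {2..n}" by (rule imageE)
  have "?F j \<le> ?F k0" if "j \<in> {2..n}" for j
    unfolding k0(1)[symmetric] using that by (intro Max_ge) auto
  with k0(2) have "is_arg_max ?F (\<lambda>k. k \<in> {2..n}) k0"
    unfolding is_arg_max_linorder by blast
  then have "is_arg_max ?F (\<lambda>k. k \<in> {2..n}) k"
    unfolding k_def k_star_def by (rule LeastI)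
  then have k: "2 \<le> k" "k \<le> n" and max: "\<And>j. 2 \<le> j \<Longrightarrow> j \<le> n \<Longrightarrow> ?F j \<le> ?F k"
    unfolding is_arg_max_linorder by auto
  have "?F k \<le> p k"
  proof -
    obtain j where j: "k = Suc j" "1 \<le> j" using k by (cases k) auto
    have "?F j \<le> ?F k"
    \<comment> \<open>Index 1 lies outside the range of maximization, but its ratio is 0.\<close>
    proof (cases "j = 1")
      case True
      have "0 \<le> (\<Sum>i\<in>{1..k}. 1 / p i)"
        using pos k by (intro sum_nonneg) (auto simp: less_imp_le)
      then show ?thesis using True j(1) by simp
    next
      case False
      then show ?thesis using max[of j] j k by auto
    qed
    moreover have "?F j \<le> ?F (Suc j) \<longleftrightarrow> ?F (Suc j) \<le> p (Suc j)"
      using pos j k by (intro ratio_Suc_le_iff(2)) auto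
    ultimately show ?thesis
      unfolding j(1) by (rule iffD1[rotated])
  qed
  moreover have "p (Suc k) \<le> ?F k" if "k < n"
  proof -
    have "?F (Suc k) \<le> ?F k \<longleftrightarrow> p (Suc k) \<le> ?F k"
      using pos k that by (intro ratio_Suc_le_iff(1)) auto
    moreover have "?F (Suc k) \<le> ?F k"
      using that k by (intro max) auto
    ultimately show ?thesis by (rule iffD1)
  qed
  ultimately show ?thesis
    unfolding k_def[symmetric] using prof k by unfold_locales
qed

section \<open>A linear-time program\<close>

lemma exec_cost: "exec P \<sigma> k \<sigma>' \<Longrightarrow> k = k' \<Longrightarrow> exec P \<sigma> k' \<sigma>'"
  by simp

text \<open>Each of the \<open>N\<close> rounds pays \<open>c\<close> and one test, and the failing
  test pays 1 more. The induction is on the number of remaining rounds.\<close>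

lemma exec_While_count:
  assumes "I 0 \<sigma>"
    and step: "\<And>j \<sigma>. j < N \<Longrightarrow> I j \<sigma> \<Longrightarrow> test_eval b \<sigma> \<and> (\<exists>\<sigma>'. exec P \<sigma> c \<sigma>' \<and> I (Suc j) \<sigma>')"
    and stop: "\<And>\<sigma>. I N \<sigma> \<Longrightarrow> \<not> test_eval b \<sigma>"
  obtains \<sigma>' where "exec (While b P) \<sigma> (N * (c + 1) + 1) \<sigma>'" "I N \<sigma>'"
proof -
  have "\<exists>\<sigma>'. exec (While b P) \<sigma> ((N - j) * (c + 1) + 1) \<sigma>' \<and> I N \<sigma>'" if "j \<le> N" "I j \<sigma>" for j \<sigma>
    using that
  proof (induction "N - j" arbitrary: j \<sigma>)
    case 0
    then show ?case using exec.WhileFalse[OF stop, of \<sigma> P] by auto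
  next
    case (Suc d)
    then have j: "j < N" by simp
    then obtain \<sigma>1 where 1: "test_eval b \<sigma>" "exec P \<sigma> c \<sigma>1" "I (Suc j) \<sigma>1"
      using step Suc.prems by blast
    have "d = N - Suc j" "Suc j \<le> N" using Suc.hyps(2) j by auto
    then obtain \<sigma>' where 2: "exec (While b P) \<sigma>1 ((N - Suc j) * (c + 1) + 1) \<sigma>'" "I N \<sigma>'"
      using Suc.hyps(1)[OF _ _ 1(3)] by blast
    have "exec (While b P) \<sigma> ((N - j) * (c + 1) + 1) \<sigma>'"
    proof (rule exec_cost[OF exec.WhileTrue[OF 1(1,2) 2(1)]])
      have "N - j = Suc (N - Suc j)" using j by simp
      then show "1 + c + ((N - Suc j) * (c + 1) + 1) = (N - j) * (c + 1) + 1" by simp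
    qed
    then show ?case using 2(2) by blast
  qed
  from this[of 0 \<sigma>] show ?thesis using assms(1) that by auto
qed

text \<open>
  Evaluating straight-line code as a function lets the simplifier normalise each intermediate
  state; chaining the rules of \<open>exec\<close> would build state terms of exponential size.
\<close>

fun straight_line :: "prog \<Rightarrow> bool" where
  "straight_line (Seq P Q) \<longleftrightarrow> straight_line P \<and> straight_line Q"
| "straight_line (IfElse b P Q) \<longleftrightarrow> False"
| "straight_line (While b P) \<longleftrightarrow> False"
| "straight_line P \<longleftrightarrow> True"

text \<open>The exact cost of straight-line code; on branches and loops this value, like that of
  \<open>final_state\<close>, is a dummy.\<close>

fun num_instructions :: "prog \<Rightarrow> nat" where
  "num_instructions (Seq P Q) = num_instructions P + num_instructions Q"
| "num_instructions P = 1"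

fun final_state :: "prog \<Rightarrow> ram_state \<Rightarrow> ram_state" where
  "final_state (IdxConst i v) \<sigma> = \<sigma>\<lparr>idx := (idx \<sigma>)(i := v)\<rparr>"
| "final_state (IdxCopy i j) \<sigma> = \<sigma>\<lparr>idx := (idx \<sigma>)(i := idx \<sigma> j)\<rparr>"
| "final_state (IdxInc i) \<sigma> = \<sigma>\<lparr>idx := (idx \<sigma>)(i := idx \<sigma> i + 1)\<rparr>"
| "final_state (RealConst r v) \<sigma> = \<sigma>\<lparr>reg := (reg \<sigma>)(r := of_rat v)\<rparr>"
| "final_state (RealCopy r r') \<sigma> = \<sigma>\<lparr>reg := (reg \<sigma>)(r := reg \<sigma> r')\<rparr>"
| "final_state (Arith f r r1 r2) \<sigma> = \<sigma>\<lparr>reg := (reg \<sigma>)(r := arith_eval f (reg \<sigma> r1) (reg \<sigma> r2))\<rparr>"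
| "final_state (Load r i) \<sigma> = \<sigma>\<lparr>reg := (reg \<sigma>)(r := mem \<sigma> (idx \<sigma> i))\<rparr>"
| "final_state (Store i r) \<sigma> = \<sigma>\<lparr>mem := (mem \<sigma>)(idx \<sigma> i := reg \<sigma> r)\<rparr>"
| "final_state (Seq P Q) \<sigma> = final_state Q (final_state P \<sigma>)"
| "final_state P \<sigma> = \<sigma>"

lemma exec_straight_line: "straight_line P \<Longrightarrow> exec P \<sigma> (num_instructions P) (final_state P \<sigma>)"
proof (induction P arbitrary: \<sigma>)
  case (Seq P Q)
  then show ?case by (auto intro: exec.Seq)
qed (simp_all add: exec.intros[simplified])

lemma straight_lineI:
  assumes "straight_line P" "num_instructions P = c" "R (final_state P \<sigma>)"
  shows "\<exists>\<sigma>'. exec P \<sigma> c \<sigma>' \<and> R \<sigma>'"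
  using exec_straight_line[OF assms(1)] assms(2,3) by blast

text \<open>After \<open>j\<close> rounds of the scan, index register 1 holds \<open>j + 1\<close>.
  Real register 0 holds the sum of reciprocals, 1 holds \<open>j - 1\<close>, 2 the constant 1, 3
  the right side of the loop test; 4 is scratch and 5 stays 0.\<close>

definition cutoff_init :: prog where
  "cutoff_init = Seq (IdxInc 1) (Seq (RealConst 1 (-1)) (RealConst 2 1))"

definition cutoff_body :: prog where
  "cutoff_body = Seq (Load 4 1) (Seq (Arith Divide 4 2 4) (Seq (Arith Plus 0 0 4)
     (Seq (Arith Plus 1 1 2) (Seq (IdxInc 1) (Seq (Load 4 1) (Arith Times 3 4 0))))))"

definition weight_body :: prog where
  "weight_body = Seq (Load 4 2) (Seq (Arith Times 4 4 0) (Seq (Arith Divide 4 2 4)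
     (Seq (Store 2 4) (IdxInc 2))))"

definition zero_body :: prog where
  "zero_body = Seq (Store 1 5) (IdxInc 1)"

text \<open>
  Cell \<open>n + 1\<close> of the input is 0 and acts as a sentinel: after \<open>n\<close> rounds the test of the first
  loop, \<open>j - 1 < p (j + 1) * (1 / p 1 + \<dots> + 1 / p j)\<close>, fails without any index comparison.
\<close>

definition cutoff_prog :: prog where
  "cutoff_prog = Seq cutoff_init (Seq (While (RealLess 1 3) cutoff_body)
     (Seq (IdxConst 2 1) (Seq (While (IdxLess 2 1) weight_body)
     (Seq (Seq (IdxCopy 3 0) (IdxInc 3)) (While (IdxLess 1 3) zero_body)))))"

text \<open>Three loops: the scan stops after \<open>k\<close> rounds, then \<open>k\<close> cells
  are overwritten by weights and the other \<open>n - k\<close> by 0.\<close>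

lemma cutoff_prog_correct:
  assumes n: "2 \<le> n" and prof: "sorted_proficiencies n p"
  shows "\<exists>k c \<sigma>. cutoff n p k \<and> exec cutoff_prog (ram_input n p) c \<sigma> \<and> c \<le> 20 * n \<and>
    (\<forall>i\<in>{1..n}. mem \<sigma> i = cutoff.lam p k i)"
proof -
  have pos: "0 < p i" if "i \<in> {1..n}" for i
    using prof that unfolding sorted_proficiencies_def by force
  define M where "M = mem (ram_input n p)"
  have M: "M i = (if i \<in> {1..n} then p i else 0)" for i
    by (simp add: M_def ram_input_def)
  define H where "H j = (\<Sum>i\<in>{1..j}. 1 / p i)" for j
  have H0: "H 0 = 0" and H_Suc: "H (Suc j) = H j + 1 / p (Suc j)" for j
    by (auto simp: H_def)
  have H_pos: "0 < H j" if "1 \<le> j" "j \<le> n" for j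
    unfolding H_def using that pos by (intro sum_pos) auto
  \<comment> \<open>The test of the scan after \<open>j\<close> rounds. For
    \<open>1 \<le> j < n\<close> it says that \<open>p (j + 1)\<close> exceeds the ratio at
    \<open>j\<close>, with the denominator cleared.\<close>
  define go where "go j \<longleftrightarrow> real j - 1 < M (Suc j) * H j" for j
  define k where "k = (LEAST j. \<not> go j)"
  have "\<not> go n" using n by (simp add: go_def M)
  then have stop: "\<not> go k" and kn: "k \<le> n"
    unfolding k_def by (rule LeastI, rule Least_le)
  have goes: "go j" if "j < k" for j
    using not_less_Least[OF that[unfolded k_def]] by simp
  \<comment> \<open>The first two tests read \<open>-1 < 0\<close> and \<open>0 < p 2 / p 1\<close>,
    so the scan cannot stop before 2.\<close>
  have "go 0" by (simp add: go_def H0)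
  with stop have "k \<noteq> 0" by (intro notI) simp
  have "go 1" using n pos[of 1] pos[of 2] by (simp add: go_def M H_def numeral_2_eq_2)
  with stop have "k \<noteq> 1" by (intro notI) simp
  with \<open>k \<noteq> 0\<close> have k2: "2 \<le> k" by simp
  have cut: "cutoff n p k"
  proof
    show "sorted_proficiencies n p" "2 \<le> k" "k \<le> n" by fact+
    obtain j where j: "k = Suc j" using k2 by (cases k) auto
    \<comment> \<open>The last successful test; adding \<open>1 = p k * (1 / p k)\<close> to both
      sides turns \<open>H j\<close> into \<open>H k\<close>. The failing test gives the other
      inequality.\<close>
    have "real j - 1 < p k * H j"
      using goes[of j] j kn by (simp add: go_def M)
    then have "real k - 1 \<le> p k * H k"
      using pos[of k] k2 kn unfolding j H_Suc by (simp add: distrib_left)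
    then show "(real k - 1) / (\<Sum>j\<in>{1..k}. 1 / p j) \<le> p k"
      using H_pos[of k] k2 kn unfolding H_def[symmetric] by (simp add: pos_divide_le_eq)
    assume "k < n"
    then show "p (Suc k) \<le> (real k - 1) / (\<Sum>j\<in>{1..k}. 1 / p j)"
      using stop H_pos[of k] k2 unfolding H_def[symmetric] by (simp add: go_def M pos_le_divide_eq)
  qed

  define I1 where "I1 j \<sigma> \<longleftrightarrow> idx \<sigma> 0 = n \<and> idx \<sigma> 1 = Suc j \<and> mem \<sigma> = M \<and> reg \<sigma> 0 = H j \<and>
    reg \<sigma> 1 = real j - 1 \<and> reg \<sigma> 2 = 1 \<and> reg \<sigma> 3 = M (Suc j) * H j \<and> reg \<sigma> 5 = 0"
    for j and \<sigma> :: ram_state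
  have "\<exists>\<sigma>. exec cutoff_init (ram_input n p) 3 \<sigma> \<and> I1 0 \<sigma>"
    unfolding cutoff_init_def
    by (rule straight_lineI)
      (auto simp: I1_def M_def H0 ram_input_def)
  then obtain \<sigma>0 where e0: "exec cutoff_init (ram_input n p) 3 \<sigma>0" and I0: "I1 0 \<sigma>0" by blast
  have step1: "\<exists>\<sigma>'. exec cutoff_body \<sigma> 7 \<sigma>' \<and> I1 (Suc j) \<sigma>'" if "j < k" "I1 j \<sigma>" for j \<sigma>
    unfolding cutoff_body_def
    by (rule straight_lineI)
      (use that kn in \<open>auto simp: I1_def M H_Suc\<close>)
  obtain \<sigma>1 where e1: "exec (While (RealLess 1 3) cutoff_body) \<sigma>0 (k * (7 + 1) + 1) \<sigma>1" and I1: "I1 k \<sigma>1"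
    using I0
  proof (rule exec_While_count[where I = I1])
    fix j \<sigma> assume "j < k" "I1 j \<sigma>"
    then show "test_eval (RealLess 1 3) \<sigma> \<and> (\<exists>\<sigma>'. exec cutoff_body \<sigma> 7 \<sigma>' \<and> I1 (Suc j) \<sigma>')"
      using step1 goes[of j] by (simp add: I1_def go_def)
  next
    fix \<sigma> assume "I1 k \<sigma>"
    then show "\<not> test_eval (RealLess 1 3) \<sigma>"
      using stop by (simp add: I1_def go_def)
  qed

  \<comment> \<open>The weights replace the input in place; index register 1, left at
    \<open>k + 1\<close> by the scan, is the loop bound.\<close>
  define I2 where "I2 j \<sigma> \<longleftrightarrow> idx \<sigma> 0 = n \<and> idx \<sigma> 1 = Suc k \<and> idx \<sigma> 2 = Suc j \<and>
    mem \<sigma> = (\<lambda>i. if i \<in> {1..j} then 1 / (p i * H k) else M i) \<and>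
    reg \<sigma> 0 = H k \<and> reg \<sigma> 2 = 1 \<and> reg \<sigma> 5 = 0"
    for j and \<sigma> :: ram_state
  have "\<exists>\<sigma>. exec (IdxConst 2 1) \<sigma>1 1 \<sigma> \<and> I2 0 \<sigma>"
    by (rule straight_lineI) (use I1 in \<open>auto simp: I1_def I2_def\<close>)
  then obtain \<sigma>2 where e2: "exec (IdxConst 2 1) \<sigma>1 1 \<sigma>2" and I2: "I2 0 \<sigma>2" by blast
  have step2: "\<exists>\<sigma>'. exec weight_body \<sigma> 5 \<sigma>' \<and> I2 (Suc j) \<sigma>'" if "j < k" "I2 j \<sigma>" for j \<sigma>
    unfolding weight_body_def
    by (rule straight_lineI)
      (use that kn in \<open>auto simp: I2_def M fun_eq_iff\<close>)
  obtain \<sigma>3 where e3: "exec (While (IdxLess 2 1) weight_body) \<sigma>2 (k * (5 + 1) + 1) \<sigma>3" and I3: "I2 k \<sigma>3"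
    using I2
  proof (rule exec_While_count[where I = I2])
    fix j \<sigma> assume "j < k" "I2 j \<sigma>"
    then show "test_eval (IdxLess 2 1) \<sigma> \<and> (\<exists>\<sigma>'. exec weight_body \<sigma> 5 \<sigma>' \<and> I2 (Suc j) \<sigma>')"
      using step2 by (simp add: I2_def)
  qed (simp add: I2_def)

  \<comment> \<open>Index register 1 now becomes the running index and continues from
    \<open>k + 1\<close>.\<close>
  define I3 where "I3 j \<sigma> \<longleftrightarrow> idx \<sigma> 1 = Suc (k + j) \<and> idx \<sigma> 3 = Suc n \<and> reg \<sigma> 5 = 0 \<and>
    (\<forall>i\<in>{1..k + j}. mem \<sigma> i = cutoff.lam p k i)"
    for j and \<sigma> :: ram_state
  have "\<exists>\<sigma>. exec (Seq (IdxCopy 3 0) (IdxInc 3)) \<sigma>3 2 \<sigma> \<and> I3 0 \<sigma>"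
    by (rule straight_lineI)
      (use I3 in \<open>auto simp: I2_def I3_def cutoff.lam_def[OF cut] cutoff.S_def[OF cut] H_def\<close>)
  then obtain \<sigma>4 where e4: "exec (Seq (IdxCopy 3 0) (IdxInc 3)) \<sigma>3 2 \<sigma>4" and I4: "I3 0 \<sigma>4" by blast
  have step3: "\<exists>\<sigma>'. exec zero_body \<sigma> 2 \<sigma>' \<and> I3 (Suc j) \<sigma>'" if "j < n - k" "I3 j \<sigma>" for j \<sigma>
    unfolding zero_body_def
    by (rule straight_lineI)
      (use that in \<open>auto simp: I3_def cutoff.lam_def[OF cut]\<close>)
  obtain \<sigma>5 where e5: "exec (While (IdxLess 1 3) zero_body) \<sigma>4 ((n - k) * (2 + 1) + 1) \<sigma>5"
    and I5: "I3 (n - k) \<sigma>5"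
    using I4
  proof (rule exec_While_count[where I = I3])
    fix j \<sigma> assume "j < n - k" "I3 j \<sigma>"
    then show "test_eval (IdxLess 1 3) \<sigma> \<and> (\<exists>\<sigma>'. exec zero_body \<sigma> 2 \<sigma>' \<and> I3 (Suc j) \<sigma>')"
      using step3 by (simp add: I3_def)
  qed (use kn in \<open>simp add: I3_def\<close>)

  have run: "exec cutoff_prog (ram_input n p)
      (3 + (k * (7 + 1) + 1 + (1 + (k * (5 + 1) + 1 + (2 + ((n - k) * (2 + 1) + 1)))))) \<sigma>5"
    unfolding cutoff_prog_def
    by (intro exec.Seq[OF e0] exec.Seq[OF e1] exec.Seq[OF e2] exec.Seq[OF e3] exec.Seq[OF e4] e5)
  \<comment> \<open>The total is \<open>9 + 11 * k + 3 * n\<close>, at most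
    \<open>14 * n + 9\<close>, and \<open>n \<ge> 2\<close> absorbs the 9.\<close>
  have cost: "3 + (k * (7 + 1) + 1 + (1 + (k * (5 + 1) + 1 + (2 + ((n - k) * (2 + 1) + 1))))) \<le> 20 * n"
  proof -
    obtain d where "n = k + d" using kn le_Suc_ex by blast
    then show ?thesis using n by simp
  qed
  have "\<forall>i\<in>{1..n}. mem \<sigma>5 i = cutoff.lam p k i"
    using I5 kn by (simp add: I3_def)
  with cut run cost show ?thesis by blast
qed

theorem mainTheorem1:
  shows "(\<forall>n m p. 2 \<le> n \<and> 1 \<le> m \<and> sorted_proficiencies n p \<longrightarrow>
            (\<exists>q. single_worker_strategy n m (lambda_star n p) q \<and>
                 (\<forall>\<delta> \<iota>. aggregator \<delta> \<longrightarrow> optimal_strategy n m p (\<lambda>_. 1) \<delta> \<iota> q)))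
       \<and> (\<exists>(P :: prog) (C :: nat). \<forall>n p. 2 \<le> n \<and> sorted_proficiencies n p \<longrightarrow>
            (\<exists>k \<sigma>. exec P (ram_input n p) k \<sigma> \<and> k \<le> C * n \<and>
               (\<forall>m\<ge>1. \<exists>q. single_worker_strategy n m (mem \<sigma>) q \<and>
                 (\<forall>\<delta> \<iota>. aggregator \<delta> \<longrightarrow> optimal_strategy n m p (\<lambda>_. 1) \<delta> \<iota> q))))"
proof (intro conjI allI impI)
  fix n m p
  assume A: "2 \<le> (n :: nat) \<and> 1 \<le> (m :: nat) \<and> sorted_proficiencies n p"
  then interpret cutoff n p "k_star n p" by (intro cutoff_k_star) auto
  have "lambda_star n p i = lam i" for i
    by (simp add: lambda_star_def lam_def S_def)
  then show "\<exists>q. single_worker_strategy n m (lambda_star n p) q \<and>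
      (\<forall>\<delta> \<iota>. aggregator \<delta> \<longrightarrow> optimal_strategy n m p (\<lambda>_. 1) \<delta> \<iota> q)"
    using A by (intro optimal) auto
next
  show "\<exists>(P :: prog) (C :: nat). \<forall>n p. 2 \<le> n \<and> sorted_proficiencies n p \<longrightarrow>
      (\<exists>k \<sigma>. exec P (ram_input n p) k \<sigma> \<and> k \<le> C * n \<and>
        (\<forall>m\<ge>1. \<exists>q. single_worker_strategy n m (mem \<sigma>) q \<and>
          (\<forall>\<delta> \<iota>. aggregator \<delta> \<longrightarrow> optimal_strategy n m p (\<lambda>_. 1) \<delta> \<iota> q)))"
  proof (rule exI[of _ cutoff_prog], rule exI[of _ 20], intro allI impI)
    fix n p
    assume A: "2 \<le> n \<and> sorted_proficiencies n p"
    obtain k c \<sigma> where cut: "cutoff n p k"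
      and run: "exec cutoff_prog (ram_input n p) c \<sigma>" "c \<le> 20 * n"
      and out: "\<forall>i\<in>{1..n}. mem \<sigma> i = cutoff.lam p k i"
      using cutoff_prog_correct[OF conjunct1[OF A] conjunct2[OF A]] by (elim exE conjE)
    show "\<exists>k \<sigma>. exec cutoff_prog (ram_input n p) k \<sigma> \<and> k \<le> 20 * n \<and>
        (\<forall>m\<ge>1. \<exists>q. single_worker_strategy n m (mem \<sigma>) q \<and>
          (\<forall>\<delta> \<iota>. aggregator \<delta> \<longrightarrow> optimal_strategy n m p (\<lambda>_. 1) \<delta> \<iota> q))"
      \<comment> \<open>\<open>lam\<close> does not involve \<open>m\<close>, so one output serves
        every number of tasks.\<close>
      by (intro exI[of _ c] exI[of _ \<sigma>] conjI allI impI run cutoff.optimal[OF cut] bspec[OF out])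
  qed
qed

end
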